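(* Let $p$ be a prime and suppose that, locally at $p$, $\alpha=\beta*\gamma^{-1}$ where $\beta$ and $\gamma$ are multiplicative arithmetic functions of degree 1 at $p$, $\beta\ne\gamma$, and neither $\beta$ nor $\gamma$ is the convolution identity $\delta$. Let $F_n=\alpha(p^n)$ and let $t'_1=\beta(p)$ be the (only non-zero) parameter of $\beta$ at $p$. Then $$F_n=(t'_1)^{n-1}F_1\qquad\text{for all } n\in\mathbb{N},\ n\ge1.$$
   Context: A multiplicative arithmetic function is a function $\alpha:\mathbb{N}_{\ge1}\to\mathbb{C}$, not identically zero, with $\alpha(mn)=\alpha(m)\alpha(n)$ whenever $\gcd(m,n)=1$. Dirichlet convolution is $(\alpha*\beta)(n)=\sum_{d\mid n}\alpha(d)\beta(n/d)$ and $\gamma^{-1}$ is the convolution inverse of $\gamma$. A multiplicative function $\beta$ has degree 1 at $p$ if $\beta(p)\ne0$ and $\beta(p^n)=\beta(p)^n$ for all $n\ge0$; its parameters at $p$ are then $t'_1=\beta(p)$ and $t'_j=0$ for $j>1$. *)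

theory Defs
  imports Complex_Main "HOL-Computational_Algebra.Primes"
begin

text \<open>
  An arithmetic function, defined on the positive integers, is represented by its unique extension
  to type \<open>nat \<Rightarrow> complex\<close> with value 0 at 0, so that equality of arithmetic functions is
  equality of HOL functions.
\<close>

definition multiplicative_fun :: "(nat \<Rightarrow> complex) \<Rightarrow> bool" where
  "multiplicative_fun f \<longleftrightarrow>
     f 0 = 0 \<and> (\<exists>n\<ge>1. f n \<noteq> 0) \<and>
     (\<forall>m\<ge>1. \<forall>n\<ge>1. coprime m n \<longrightarrow> f (m * n) = f m * f n)"

text \<open>At \<open>n = 0\<close> the index set is infinite, so the sum is 0, as the representation requires.\<close>

definition dirichlet_conv ::
  "(nat \<Rightarrow> complex) \<Rightarrow> (nat \<Rightarrow> complex) \<Rightarrow> nat \<Rightarrow> complex" where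
  "dirichlet_conv f g n = (\<Sum>d | d dvd n. f d * g (n div d))"

definition conv_id :: "nat \<Rightarrow> complex" where
  "conv_id n = (if n = 1 then 1 else 0)"

text \<open>
  The inverse exists and is unique whenever \<open>f 1 \<noteq> 0\<close>, in particular for multiplicative \<open>f\<close>;
  the condition \<open>g 0 = 0\<close> is needed because the convolution does not depend on \<open>g 0\<close>.
\<close>

definition dirichlet_inv :: "(nat \<Rightarrow> complex) \<Rightarrow> nat \<Rightarrow> complex" where
  "dirichlet_inv f = (THE g. g 0 = 0 \<and> dirichlet_conv f g = conv_id)"

definition degree_one_at :: "nat \<Rightarrow> (nat \<Rightarrow> complex) \<Rightarrow> bool" where
  "degree_one_at p f \<longleftrightarrow> f p \<noteq> 0 \<and> (\<forall>n. f (p ^ n) = f p ^ n)"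

text \<open>The parameters \<open>t'\<^sub>1, t'\<^sub>2, \<dots>\<close> of a function of degree one at \<open>p\<close>; the index 0 is not used.\<close>

definition degree_one_param :: "nat \<Rightarrow> (nat \<Rightarrow> complex) \<Rightarrow> nat \<Rightarrow> complex" where
  "degree_one_param p f j = (if j = 1 then f p else 0)"

definition eq_locally_at ::
  "nat \<Rightarrow> (nat \<Rightarrow> complex) \<Rightarrow> (nat \<Rightarrow> complex) \<Rightarrow> bool" where
  "eq_locally_at p f g \<longleftrightarrow> (\<forall>n. f (p ^ n) = g (p ^ n))"

end

theory Submission
  imports Defs
begin

text \<open>
  Convolving a function \<open>f\<close> of degree one at \<open>p\<close> with \<open>h\<close> gives the recursion
  \<open>(f * h)(p\<^sup>n\<^sup>+\<^sup>1) = h(p\<^sup>n\<^sup>+\<^sup>1) + f(p) (f * h)(p\<^sup>n)\<close>. With \<open>f = \<gamma>\<close> and \<open>h = \<gamma>\<^sup>-\<^sup>1\<close> it shows that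
  \<open>\<gamma>\<^sup>-\<^sup>1\<close> vanishes at \<open>p\<^sup>n\<close> for \<open>n \<ge> 2\<close>; with \<open>f = \<beta>\<close> and the same \<open>h\<close> it then reduces to
  \<open>F\<^sub>n\<^sub>+\<^sub>1 = \<beta>(p) F\<^sub>n\<close> for \<open>n \<ge> 1\<close>.
\<close>

lemma dirichlet_conv_0 [simp]: "dirichlet_conv f g 0 = 0"
  by (simp add: dirichlet_conv_def)

lemma div_less_of_dvd:
  fixes d n :: nat
  assumes "n > 0" "d dvd n" "d \<noteq> 1"
  shows "n div d < n"
proof (rule div_less_dividend)
  show "1 < d"
    using assms dvd_pos_nat[of n d] by linarith
qed (rule assms(1))

lemma dirichlet_conv_split_1:
  assumes "n > 0"
  shows "dirichlet_conv f g n = f 1 * g n + (\<Sum>d | d dvd n \<and> d \<noteq> 1. f d * g (n div d))"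
proof -
  have "{d. d dvd n} = insert 1 {d. d dvd n \<and> d \<noteq> 1}"
    by auto
  moreover have "finite {d. d dvd n \<and> d \<noteq> 1}"
    using assms by (auto intro: finite_subset[OF _ finite_divisors_nat])
  ultimately show ?thesis
    by (simp add: dirichlet_conv_def)
qed

text \<open>Solves \<open>dirichlet_conv f g n = conv_id n\<close> for \<open>g n\<close> by
  isolating the term \<open>d = 1\<close>. The guard \<open>n div d < n\<close> holds for every
  \<open>d\<close> in the sum when \<open>n > 0\<close>; it makes termination evident.\<close>

fun dirichlet_inv_rec :: "(nat \<Rightarrow> complex) \<Rightarrow> nat \<Rightarrow> complex" where
  "dirichlet_inv_rec f n = (if n = 0 then 0 else
     (conv_id n -
      (\<Sum>d\<in>{d. d dvd n \<and> d \<noteq> 1}. f d * (if n div d < n then dirichlet_inv_rec f (n div d) else 0))) / f 1)"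

declare dirichlet_inv_rec.simps [simp del]

lemma dirichlet_inv_rec_0 [simp]: "dirichlet_inv_rec f 0 = 0"
  by (subst dirichlet_inv_rec.simps) simp

lemma dirichlet_conv_inv_rec:
  assumes "f 1 \<noteq> 0"
  shows "dirichlet_conv f (dirichlet_inv_rec f) = conv_id"
proof
  fix n
  show "dirichlet_conv f (dirichlet_inv_rec f) n = conv_id n"
  proof (cases "n = 0")
    case False
    have "(\<Sum>d | d dvd n \<and> d \<noteq> 1. f d * (if n div d < n then dirichlet_inv_rec f (n div d) else 0))
        = (\<Sum>d | d dvd n \<and> d \<noteq> 1. f d * dirichlet_inv_rec f (n div d))"
      using False by (intro sum.cong) (simp_all add: div_less_of_dvd)
    then have "f 1 * dirichlet_inv_rec f n
        = conv_id n - (\<Sum>d | d dvd n \<and> d \<noteq> 1. f d * dirichlet_inv_rec f (n div d))"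
      using False assms by (subst dirichlet_inv_rec.simps) simp
    then show ?thesis
      using False by (simp add: dirichlet_conv_split_1)
  qed (simp add: conv_id_def)
qed

text \<open>Strong induction: beyond the term \<open>d = 1\<close>, only smaller arguments of
  \<open>g\<close> and \<open>h\<close> occur, so \<open>f 1\<close> can be cancelled. The
  convolution does not see the value at 0, hence \<open>g 0 = h 0\<close>.\<close>

lemma dirichlet_conv_left_cancel:
  assumes "f 1 \<noteq> 0" "g 0 = h 0" "dirichlet_conv f g = dirichlet_conv f h"
  shows "g = h"
proof
  fix n
  show "g n = h n"
  proof (induction n rule: less_induct)
    case (less n)
    show ?case
    proof (cases "n = 0")
      case False
      have "(\<Sum>d | d dvd n \<and> d \<noteq> 1. f d * g (n div d)) = (\<Sum>d | d dvd n \<and> d \<noteq> 1. f d * h (n div d))"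
        using False
        by (intro sum.cong) (simp_all add: less div_less_of_dvd)
      moreover have "dirichlet_conv f g n = dirichlet_conv f h n"
        using assms(3) by simp
      ultimately show ?thesis
        using False assms(1) by (simp add: dirichlet_conv_split_1)
    qed (simp add: assms(2))
  qed
qed

text \<open>Justifies the definite description: the recursion gives existence, cancellation gives
  uniqueness.\<close>

lemma dirichlet_conv_dirichlet_inv:
  assumes "f 1 \<noteq> 0"
  shows "dirichlet_conv f (dirichlet_inv f) = conv_id"
proof -
  have "\<exists>!g. g 0 = 0 \<and> dirichlet_conv f g = conv_id"
  proof (rule ex1I)
    show "dirichlet_inv_rec f 0 = 0 \<and> dirichlet_conv f (dirichlet_inv_rec f) = conv_id"
      using dirichlet_conv_inv_rec[of f] assms by simp
  next
    fix g
    assume "g 0 = 0 \<and> dirichlet_conv f g = conv_id"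
    then show "g = dirichlet_inv_rec f"
      using assms dirichlet_conv_inv_rec[of f]
      by (simp add: dirichlet_conv_left_cancel[of f])
  qed
  from theI'[OF this] show ?thesis
    by (simp add: dirichlet_inv_def)
qed

text \<open>The divisors of \<open>p ^ n\<close> are the powers \<open>p ^ i\<close> with
  \<open>i \<le> n\<close>, distinct since \<open>p > 1\<close>, so the sum is reindexed by
  exponents.\<close>

lemma dirichlet_conv_prime_power:
  assumes "prime p"
  shows "dirichlet_conv f g (p ^ n) = (\<Sum>i\<le>n. f (p ^ i) * g (p ^ (n - i)))"
proof -
  have p: "p > 1"
    using assms by (rule prime_gt_1_nat)
  have "{d. d dvd p ^ n} = (\<lambda>i. p ^ i) ` {..n}"
    using assms by (auto simp: divides_primepow_nat)
  moreover have "inj_on (\<lambda>i. p ^ i) {..n}"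
    using p by (auto intro: inj_onI)
  ultimately have "dirichlet_conv f g (p ^ n) = (\<Sum>i\<le>n. f (p ^ i) * g (p ^ n div p ^ i))"
    by (simp add: dirichlet_conv_def sum.reindex)
  also have "\<dots> = (\<Sum>i\<le>n. f (p ^ i) * g (p ^ (n - i)))"
    using p by (intro sum.cong) (auto simp: power_diff)
  finally show ?thesis .
qed

lemma degree_one_at_1: "degree_one_at p f \<Longrightarrow> f 1 = 1"
  unfolding degree_one_at_def by (metis power_0)

text \<open>The term \<open>i = 0\<close> is \<open>g (p ^ Suc n)\<close>; every later term contains
  a factor \<open>f p\<close>, and pulling it out leaves the sum for \<open>p ^ n\<close>.\<close>

lemma dirichlet_conv_degree_one_Suc:
  assumes "prime p" "degree_one_at p f"
  shows "dirichlet_conv f g (p ^ Suc n) = g (p ^ Suc n) + f p * dirichlet_conv f g (p ^ n)"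
proof -
  have f: "f (p ^ i) = f p ^ i" for i
    using assms(2) by (simp add: degree_one_at_def)
  show ?thesis
    unfolding dirichlet_conv_prime_power[OF assms(1)] f sum.atMost_Suc_shift sum_distrib_left
    by (simp add: mult.assoc)
qed

lemma dirichlet_inv_degree_one_eq_0:
  assumes "prime p" "degree_one_at p f" "n \<ge> 1"
  shows "dirichlet_inv f (p ^ Suc n) = 0"
proof -
  have conv: "dirichlet_conv f (dirichlet_inv f) = conv_id"
    using degree_one_at_1[OF assms(2)] by (intro dirichlet_conv_dirichlet_inv) simp
  have "conv_id (p ^ k) = 0" if "k \<ge> 1" for k
    using that prime_gt_1_nat[OF assms(1)] by (simp add: conv_id_def)
  \<comment> \<open>Here \<open>n \<ge> 1\<close> matters: for \<open>n = 0\<close> the second value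
    is 1, and the inverse takes the value \<open>- f p\<close> at \<open>p\<close>.\<close>
  then have "conv_id (p ^ Suc n) = 0" "conv_id (p ^ n) = 0"
    using assms(3) by (simp_all del: power_Suc)
  then show ?thesis
    using dirichlet_conv_degree_one_Suc[OF assms(1,2), of "dirichlet_inv f" n]
    unfolding conv by simp
qed

theorem proposition8:
  fixes p :: nat and \<alpha> \<beta> \<gamma> :: "nat \<Rightarrow> complex" and F t' :: "nat \<Rightarrow> complex"
  assumes "prime p"
    and "multiplicative_fun \<beta>" and "multiplicative_fun \<gamma>"
    and "degree_one_at p \<beta>" and "degree_one_at p \<gamma>"
    and "\<beta> \<noteq> \<gamma>" and "\<beta> \<noteq> conv_id" and "\<gamma> \<noteq> conv_id"
    and "eq_locally_at p \<alpha> (dirichlet_conv \<beta> (dirichlet_inv \<gamma>))"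
    and "\<And>n. F n = \<alpha> (p ^ n)"
    and "t' = degree_one_param p \<beta>"
  shows "\<forall>n\<ge>1. F n = t' 1 ^ (n - 1) * F 1"
proof (intro allI impI)
  have F: "F n = dirichlet_conv \<beta> (dirichlet_inv \<gamma>) (p ^ n)" for n
    using assms(9,10) by (simp add: eq_locally_at_def)
  have t': "t' 1 = \<beta> p"
    using assms(11) by (simp add: degree_one_param_def)
  have F_Suc: "F (Suc n) = t' 1 * F n" if "n \<ge> 1" for n
    unfolding F t' dirichlet_conv_degree_one_Suc[OF \<open>prime p\<close> \<open>degree_one_at p \<beta>\<close>]
      dirichlet_inv_degree_one_eq_0[OF \<open>prime p\<close> \<open>degree_one_at p \<gamma>\<close> that]
    by simp
  fix n :: nat
  assume "n \<ge> 1"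
  then show "F n = t' 1 ^ (n - 1) * F 1"
  proof (induction n rule: dec_induct)
    case (step n)
    \<comment> \<open>The exponent \<open>Suc (n - 1)\<close> equals \<open>n\<close> because the
      induction starts at 1.\<close>
    then have "F (Suc n) = t' 1 ^ Suc (n - 1) * F 1"
      by (simp only: F_Suc power_Suc mult.assoc)
    with step show ?case
      by simp
  qed simp
qed

end
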